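(* Let $d\geq 1$ be an integer, let $S\subseteq\mathbb{Z}^d$ be a finite set, let $\Sigma$ be a finite alphabet, and let $\Gamma\subseteq\mathcal{P}(\Sigma^S)$ be a semiconstrained system. Then $$h_{\mathrm{ind}}(\Gamma)\leq\mathsf{cap}(\Gamma),$$ where $h_{\mathrm{ind}}$ denotes the independence entropy and $\mathsf{cap}$ the capacity.
   Context: Notation: $[n]=\{0,1,\dots,n-1\}$; $F_n^d=[n]^d\subset\mathbb{Z}^d$. $\mathcal{P}(X)$ is the set of probability measures on $X$. The total variation distance is $\|\mu-\nu\|_{TV}=\sup_W|\mu(W)-\nu(W)|$. A ($\mathbb{Z}^d$-)semiconstrained system (SCS) is a set $\Gamma\subseteq\mathcal{P}(\Sigma^S)$ for a finite $S\subseteq\mathbb{Z}^d$. For $\epsilon>0$, $\mathbb{B}_\epsilon(\Gamma)=\{\mu\in\mathcal{P}(\Sigma^S): \inf_{\nu\in\Gamma}\|\mu-\nu\|_{TV}\le\epsilon\}$. Empirical distribution: for $w\in\Sigma^{F_n^d}$ let $\hat w\in\Sigma^{\mathbb{Z}^d}$, $\hat w_{\mathbf v}=w_{\mathbf v \bmod n}$ (entrywise), and let $\mathrm{fr}^S_w\in\mathcal{P}(\Sigma^S)$ be the law of $(\hat w_{\mathbf v+\mathbf s})_{\mathbf s\in S}$ for $\mathbf v$ uniform in $F_n^d$. Admissible blocks: $\mathcal{B}_n(\Gamma)=\{w\in\Sigma^{F_n^d}:\mathrm{fr}^S_w\in\Gamma\}$. Capacity: $\mathsf{cap}(\Gamma)=\lim_{\epsilon\to0^+}\limsup_{n\to\infty}\frac1{n^d}\log_2|\mathcal{B}_n(\mathbb{B}_\epsilon(\Gamma))|$.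 Independence entropy: for $\mu\in\mathcal{P}(\Sigma^{F_n^d})$ let $\overline{\pi}_S(\mu)=\frac1{n^d}\sum_{\mathbf v\in F_n^d}\pi_{S+\mathbf v}(\mu)\in\mathcal{P}(\Sigma^S)$, where coordinates of $S+\mathbf v$ are taken modulo $n$, i.e. $\pi_{S+\mathbf v}(\mu)$ is the law of $(x_{(\mathbf s+\mathbf v)\bmod n})_{\mathbf s\in S}$ when $x\sim\mu$. Let $\overline{\mathcal{P}}_n(\Gamma)$ be the set of product measures $\mu=\prod_{\mathbf v\in F_n^d}p_{\mathbf v}$, $p_{\mathbf v}\in\mathcal{P}(\Sigma)$, on $\Sigma^{F_n^d}$ with $\overline{\pi}_S(\mu)\in\Gamma$. With $H(\mu)=-\sum_w\mu(w)\log_2\mu(w)$, set $\widehat{h_{\mathrm{ind}}}(\Gamma)=\limsup_{n\to\infty}\sup_{\mu\in\overline{\mathcal{P}}_n(\Gamma)}\frac1{n^d}H(\mu)$ and $h_{\mathrm{ind}}(\Gamma)=\lim_{\epsilon\to0^+}\widehat{h_{\mathrm{ind}}}(\mathbb{B}_\epsilon(\Gamma))$. Conventions: $\log_2 0=-\infty$ and $\sup\emptyset=-\infty$. *)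

theory Defs
  imports "HOL-Probability.Probability"
begin

text \<open>
  The lattice of dimension \<open>d\<close> is \<^typ>\<open>int ^ 'd\<close> with \<open>d = CARD('d)\<close>, the alphabet is a type
  of class \<^class>\<open>finite\<close>. A configuration over a set of sites is an extensional function.
  Configuration spaces over finite sets of sites are finite, so each probability measure on
  them is a \<open>pmf\<close>.
\<close>

definition configs :: "'v set \<Rightarrow> ('v \<Rightarrow> 'a) set" where
  "configs A = A \<rightarrow>\<^sub>E UNIV"

definition prob_measures :: "'v set \<Rightarrow> ('v \<Rightarrow> 'a) pmf set" where
  "prob_measures A = {\<mu>. set_pmf \<mu> \<subseteq> configs A}"

definition semiconstrained_system ::
    "(int ^ 'd) set \<Rightarrow> (int ^ 'd \<Rightarrow> 'a::finite) pmf set \<Rightarrow> bool" where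
  "semiconstrained_system S \<Gamma> \<longleftrightarrow> \<Gamma> \<subseteq> prob_measures S"

definition tv_distance :: "'b pmf \<Rightarrow> 'b pmf \<Rightarrow> real" where
  "tv_distance \<mu> \<nu> = (SUP W. \<bar>measure_pmf.prob \<mu> W - measure_pmf.prob \<nu> W\<bar>)"

text \<open>
  The infimum is taken in \<^typ>\<open>ereal\<close>, where the infimum over the empty set is \<open>\<infinity>\<close>; so the
  neighbourhood of the empty system is empty.
\<close>

definition neighbourhood ::
    "real \<Rightarrow> 'v set \<Rightarrow> ('v \<Rightarrow> 'a) pmf set \<Rightarrow> ('v \<Rightarrow> 'a) pmf set" where
  "neighbourhood \<epsilon> S \<Gamma> =
     {\<mu> \<in> prob_measures S. (INF \<nu>\<in>\<Gamma>. ereal (tv_distance \<mu> \<nu>)) \<le> ereal \<epsilon>}"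

definition cube :: "nat \<Rightarrow> (int ^ 'd) set" where
  "cube n = {v. \<forall>i. 0 \<le> v $ i \<and> v $ i < int n}"

definition vmod :: "int ^ 'd \<Rightarrow> nat \<Rightarrow> int ^ 'd" where
  "vmod v n = (\<chi> i. (v $ i) mod int n)"

definition periodic_ext :: "nat \<Rightarrow> (int ^ 'd \<Rightarrow> 'a) \<Rightarrow> int ^ 'd \<Rightarrow> 'a" where
  "periodic_ext n w = (\<lambda>v. w (vmod v n))"

definition window :: "(int ^ 'd) set \<Rightarrow> int ^ 'd \<Rightarrow> (int ^ 'd \<Rightarrow> 'a) \<Rightarrow> int ^ 'd \<Rightarrow> 'a" where
  "window S v x = (\<lambda>s\<in>S. x (v + s))"

definition empirical :: "nat \<Rightarrow> (int ^ 'd) set \<Rightarrow> (int ^ 'd \<Rightarrow> 'a) \<Rightarrow> (int ^ 'd \<Rightarrow> 'a) pmf" where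
  "empirical n S w = map_pmf (\<lambda>v. window S v (periodic_ext n w)) (pmf_of_set (cube n))"

definition admissible_blocks ::
    "nat \<Rightarrow> (int ^ 'd) set \<Rightarrow> (int ^ 'd \<Rightarrow> 'a) pmf set \<Rightarrow> (int ^ 'd \<Rightarrow> 'a) set" where
  "admissible_blocks n S \<Gamma> = {w \<in> configs (cube n). empirical n S w \<in> \<Gamma>}"

definition elog2 :: "nat \<Rightarrow> ereal" where
  "elog2 k = (if k = 0 then -\<infinity> else ereal (log 2 (real k)))"

definition block_growth_rate :: "(int ^ 'd) set \<Rightarrow> (int ^ 'd \<Rightarrow> 'a) pmf set \<Rightarrow> ereal" where
  "block_growth_rate S \<Gamma> =
     limsup (\<lambda>n. ereal (1 / real n ^ CARD('d)) * elog2 (card (admissible_blocks n S \<Gamma>)))"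

definition capacity :: "(int ^ 'd) set \<Rightarrow> (int ^ 'd \<Rightarrow> 'a) pmf set \<Rightarrow> ereal" where
  "capacity S \<Gamma> = Lim (at_right 0) (\<lambda>\<epsilon>. block_growth_rate S (neighbourhood \<epsilon> S \<Gamma>))"

definition marginal ::
    "nat \<Rightarrow> (int ^ 'd) set \<Rightarrow> int ^ 'd \<Rightarrow> (int ^ 'd \<Rightarrow> 'a) pmf \<Rightarrow> (int ^ 'd \<Rightarrow> 'a) pmf" where
  "marginal n S v \<mu> = map_pmf (\<lambda>x. window S v (periodic_ext n x)) \<mu>"

text \<open>The average over the cube is a uniform mixture; \<open>pmf_averaged_marginal\<close> below spells it out.\<close>

definition averaged_marginal ::
    "nat \<Rightarrow> (int ^ 'd) set \<Rightarrow> (int ^ 'd \<Rightarrow> 'a) pmf \<Rightarrow> (int ^ 'd \<Rightarrow> 'a) pmf" where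
  "averaged_marginal n S \<mu> = bind_pmf (pmf_of_set (cube n)) (\<lambda>v. marginal n S v \<mu>)"

text \<open>
  \<^term>\<open>Pi_pmf A undefined p\<close> gives the value \<^term>\<open>undefined\<close> to all sites outside \<open>A\<close>,
  so its support consists of extensional functions.
\<close>

definition admissible_products ::
    "nat \<Rightarrow> (int ^ 'd) set \<Rightarrow> (int ^ 'd \<Rightarrow> 'a) pmf set \<Rightarrow> (int ^ 'd \<Rightarrow> 'a) pmf set" where
  "admissible_products n S \<Gamma> =
     {\<mu>. (\<exists>p. \<mu> = Pi_pmf (cube n) undefined p) \<and> averaged_marginal n S \<mu> \<in> \<Gamma>}"

definition entropy2 :: "'v set \<Rightarrow> ('v \<Rightarrow> 'a) pmf \<Rightarrow> real" where
  "entropy2 A \<mu> = - (\<Sum>w\<in>configs A. pmf \<mu> w * log 2 (pmf \<mu> w))"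

definition h_ind_hat :: "(int ^ 'd) set \<Rightarrow> (int ^ 'd \<Rightarrow> 'a) pmf set \<Rightarrow> ereal" where
  "h_ind_hat S \<Gamma> = limsup (\<lambda>n. SUP \<mu>\<in>admissible_products n S \<Gamma>.
     ereal (1 / real n ^ CARD('d) * entropy2 (cube n) \<mu>))"

definition h_ind :: "(int ^ 'd) set \<Rightarrow> (int ^ 'd \<Rightarrow> 'a) pmf set \<Rightarrow> ereal" where
  "h_ind S \<Gamma> = Lim (at_right 0) (\<lambda>\<epsilon>. h_ind_hat S (neighbourhood \<epsilon> S \<Gamma>))"

lemma finite_cube: "finite (cube n :: (int ^ 'd) set)"
proof (rule finite_imageD)
  have "vec_nth ` (cube n :: (int ^ 'd) set) \<subseteq> UNIV \<rightarrow>\<^sub>E {0..<int n}"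
    by (auto simp: cube_def)
  then show "finite (vec_nth ` (cube n :: (int ^ 'd) set))"
    by (rule finite_subset) (intro finite_PiE; simp)
  show "inj_on vec_nth (cube n :: (int ^ 'd) set)"
    by (simp add: inj_on_def vec_nth_inject)
qed

lemma card_cube: "card (cube n :: (int ^ 'd) set) = n ^ CARD('d)"
proof -
  have "vec_nth ` (cube n :: (int ^ 'd) set) = UNIV \<rightarrow>\<^sub>E {0..<int n}"
  proof (intro set_eqI iffI)
    fix f :: "'d \<Rightarrow> int"
    assume "f \<in> UNIV \<rightarrow>\<^sub>E {0..<int n}"
    then have "vec_lambda f \<in> cube n" by (auto simp: cube_def PiE_iff)
    then have "vec_nth (vec_lambda f) \<in> vec_nth ` cube n" by (rule imageI)
    then show "f \<in> vec_nth ` cube n" by (simp add: vec_lambda_inverse)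
  qed (auto simp: cube_def)
  moreover have "card (vec_nth ` (cube n :: (int ^ 'd) set)) = card (cube n :: (int ^ 'd) set)"
    by (rule card_image) (simp add: inj_on_def vec_nth_inject)
  ultimately show ?thesis by (simp add: card_PiE)
qed

lemma pmf_averaged_marginal:
  fixes S :: "(int ^ 'd) set"
  assumes "n > 0"
  shows "pmf (averaged_marginal n S \<mu>) x =
    1 / real n ^ CARD('d) * (\<Sum>v\<in>cube n. pmf (marginal n S v \<mu>) x)"
proof -
  have "(0 :: int ^ 'd) \<in> cube n" using assms by (simp add: cube_def)
  then have "(cube n :: (int ^ 'd) set) \<noteq> {}" by blast
  then show ?thesis
    by (simp add: averaged_marginal_def pmf_bind integral_pmf_of_set finite_cube card_cube)
qed

text \<open>Both quantities under the limit in \<open>\<epsilon>\<close> are monotone, so the two limits exist.\<close>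

lemma neighbourhood_mono: "\<delta> \<le> \<epsilon> \<Longrightarrow> neighbourhood \<delta> S \<Gamma> \<subseteq> neighbourhood \<epsilon> S \<Gamma>"
  by (auto simp: neighbourhood_def elim: order_trans)

lemma tendsto_Lim_at_right_0:
  fixes f :: "real \<Rightarrow> ereal"
  assumes "\<And>\<delta> \<epsilon>. 0 < \<delta> \<Longrightarrow> \<delta> \<le> \<epsilon> \<Longrightarrow> f \<delta> \<le> f \<epsilon>"
  shows "(f \<longlongrightarrow> Lim (at_right 0) f) (at_right 0)"
proof -
  have "(f \<longlongrightarrow> Inf (f ` ({0<..} \<inter> UNIV))) (at 0 within ({0<..} \<inter> UNIV))"
    by (rule Lim_right_bound[where K = "-\<infinity>"]) (use assms in auto)
  then have "(f \<longlongrightarrow> Inf (f ` {0<..})) (at_right 0)" by simp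
  moreover from this have "Lim (at_right 0) f = Inf (f ` {0<..})"
    by (intro tendsto_Lim) simp_all
  ultimately show ?thesis by simp
qed

lemma finite_admissible_blocks:
  "finite (admissible_blocks n S \<Gamma> :: (int ^ 'd \<Rightarrow> 'a::finite) set)"
proof (rule finite_subset)
  show "admissible_blocks n S \<Gamma> \<subseteq> configs (cube n)" by (auto simp: admissible_blocks_def)
  show "finite (configs (cube n) :: (int ^ 'd \<Rightarrow> 'a) set)"
    unfolding configs_def by (intro finite_PiE finite_cube) simp
qed

lemma elog2_mono: "j \<le> k \<Longrightarrow> elog2 j \<le> elog2 k"
  by (simp add: elog2_def)

lemma capacity_tendsto:
  fixes \<Gamma> :: "(int ^ 'd \<Rightarrow> 'a::finite) pmf set"
  shows "((\<lambda>\<epsilon>. block_growth_rate S (neighbourhood \<epsilon> S \<Gamma>)) \<longlongrightarrow> capacity S \<Gamma>) (at_right 0)"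
  unfolding capacity_def
proof (rule tendsto_Lim_at_right_0)
  fix \<delta> \<epsilon> :: real
  assume "\<delta> \<le> \<epsilon>"
  from neighbourhood_mono[OF this] have
    "admissible_blocks n S (neighbourhood \<delta> S \<Gamma>) \<subseteq> admissible_blocks n S (neighbourhood \<epsilon> S \<Gamma>)" for n
    by (auto simp: admissible_blocks_def)
  then show "block_growth_rate S (neighbourhood \<delta> S \<Gamma>) \<le> block_growth_rate S (neighbourhood \<epsilon> S \<Gamma>)"
    unfolding block_growth_rate_def
    by (intro Limsup_mono always_eventually allI ereal_mult_left_mono elog2_mono card_mono
        finite_admissible_blocks) simp_all
qed

lemma h_ind_tendsto:
  fixes \<Gamma> :: "(int ^ 'd \<Rightarrow> 'a::finite) pmf set"
  shows "((\<lambda>\<epsilon>. h_ind_hat S (neighbourhood \<epsilon> S \<Gamma>)) \<longlongrightarrow> h_ind S \<Gamma>) (at_right 0)"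
  unfolding h_ind_def
proof (rule tendsto_Lim_at_right_0)
  fix \<delta> \<epsilon> :: real
  assume "\<delta> \<le> \<epsilon>"
  from neighbourhood_mono[OF this] have
    "admissible_products n S (neighbourhood \<delta> S \<Gamma>) \<subseteq> admissible_products n S (neighbourhood \<epsilon> S \<Gamma>)" for n
    by (auto simp: admissible_products_def)
  then show "h_ind_hat S (neighbourhood \<delta> S \<Gamma>) \<le> h_ind_hat S (neighbourhood \<epsilon> S \<Gamma>)"
    unfolding h_ind_hat_def
    by (intro Limsup_mono always_eventually allI SUP_subset_mono) simp_all
qed

end

theory Submission
  imports Defs
begin

text \<open>
  A random block drawn from an admissible product measure is, with high probability, itself an
  (almost) admissible block, and a measure carried mostly by a set \<open>A\<close> cannot have much more
  entropy than \<open>log\<^sub>2 |A|\<close>. These two facts bound the independence entropy by the capacity, and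
  they do so at one and the same size \<open>n\<close>, so no limit of block sizes has to be rearranged.

  In detail, let \<open>x\<close> be drawn from a product measure \<open>\<mu>\<close> on the blocks of size \<open>n\<close>. The frequency of a
  pattern \<open>\<sigma>\<close> in \<open>x\<close> is an average of \<open>n\<^sup>d\<close> indicators, one for each window, and its expectation is
  the weight of \<open>\<sigma>\<close> under the averaged marginal of \<open>\<mu>\<close>. As the coordinates of \<open>x\<close> are independent,
  the windows at \<open>v\<close> and \<open>v'\<close> are independent unless they share a site modulo \<open>n\<close>, which for given \<open>v\<close>
  happens for at most \<open>|S|\<^sup>2\<close> positions \<open>v'\<close>. The variance of the frequency is therefore at most
  \<open>|S|\<^sup>2 / n\<^sup>d\<close>, and Chebyshev's inequality (\<open>pattern_frequency_concentration\<close>) with a union bound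
  over the finitely many patterns shows that the empirical distribution of \<open>x\<close> is within \<open>\<epsilon>\<close> of the
  averaged marginal, except with probability \<open>\<eta> = O(1/n\<^sup>d)\<close>
  (\<open>prob_not_admissible_le\<close>). The constant depends on \<open>S\<close>, \<open>\<epsilon>\<close> and the alphabet only, so the
  estimate is uniform in \<open>\<mu>\<close>. If the averaged marginal lies in the \<open>\<epsilon>\<close>-neighbourhood of the system,
  all other \<open>x\<close> are admissible for the \<open>2\<epsilon>\<close>-neighbourhood.

  Once \<open>n\<close> is so large that \<open>\<eta> < 1\<close>, Gibbs' inequality (\<open>entropy_le_log_card_of_likely_set\<close>) gives
  \<open>H(\<mu>) \<le> 1 + log\<^sub>2 |A| + \<eta> n\<^sup>d log\<^sub>2 |\<Sigma>|\<close> for the set \<open>A\<close> of these blocks. Dividing by \<open>n\<^sup>d\<close>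
  and passing to the limit superior compares the two quantities at \<open>\<epsilon>\<close> and \<open>2\<epsilon>\<close>, and the factor
  disappears as \<open>\<epsilon>\<close> tends to \<open>0\<close>.
\<close>

section \<open>Entropy of a measure concentrated on a set\<close>

text \<open>
  Gibbs' inequality: it is the bound \<open>ln t \<le> t - 1\<close> at \<open>t = q x / p x\<close>, averaged over \<open>p\<close>.
\<close>

lemma entropy_le_cross_entropy:
  assumes "finite \<Omega>" "set_pmf p \<subseteq> \<Omega>"
    and q_pos: "\<And>x. x \<in> \<Omega> \<Longrightarrow> 0 < q x" and q_sum: "sum q \<Omega> \<le> 1"
  shows "- (\<Sum>x\<in>\<Omega>. pmf p x * log 2 (pmf p x)) \<le> - (\<Sum>x\<in>\<Omega>. pmf p x * log 2 (q x))"
proof -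
  have "(\<Sum>x\<in>\<Omega>. pmf p x * log 2 (q x) - pmf p x * log 2 (pmf p x))
      \<le> (\<Sum>x\<in>\<Omega>. (q x - pmf p x) / ln 2)"
  proof (rule sum_mono)
    fix x assume x: "x \<in> \<Omega>"
    show "pmf p x * log 2 (q x) - pmf p x * log 2 (pmf p x) \<le> (q x - pmf p x) / ln 2"
    proof (cases "pmf p x = 0")
      case True
      then show ?thesis using q_pos[OF x] by simp
    next
      case False
      then have p: "0 < pmf p x" by (simp add: pmf_nonneg less_le)
      have "ln (q x / pmf p x) \<le> q x / pmf p x - 1"
        using p q_pos[OF x] by (intro ln_le_minus_one) simp
      then have "pmf p x * (ln (q x) - ln (pmf p x)) \<le> pmf p x * (q x / pmf p x - 1)"
        using p q_pos[OF x] by (simp add: ln_div)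
      also have "\<dots> = q x - pmf p x" using p by (simp add: field_simps)
      finally have "pmf p x * (ln (q x) - ln (pmf p x)) / ln 2 \<le> (q x - pmf p x) / ln 2"
        by (simp add: divide_right_mono)
      then show ?thesis by (simp add: log_def algebra_simps diff_divide_distrib)
    qed
  qed
  also have "\<dots> = (sum q \<Omega> - 1) / ln 2"
    using sum_pmf_eq_1[OF assms(1,2)] by (simp flip: sum_divide_distrib add: sum_subtractf)
  also have "\<dots> \<le> 0" using q_sum by (simp add: divide_nonpos_pos)
  finally show ?thesis by (simp add: sum_subtractf)
qed

text \<open>
  The reference measure puts half of its mass uniformly on \<open>A\<close> and at most the other half uniformly
  on the rest, which costs one bit. Beyond that bit a point of \<open>A\<close> costs \<open>log\<^sub>2 |A|\<close>, and a point outside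
  \<open>A\<close> costs \<open>log\<^sub>2 |\<Omega>|\<close>, but the latter is paid with probability at most \<open>\<eta>\<close> only.
\<close>

lemma entropy_le_log_card_of_likely_set:
  assumes "finite \<Omega>" "set_pmf p \<subseteq> \<Omega>" "A \<subseteq> \<Omega>"
    and unlikely: "measure_pmf.prob p (\<Omega> - A) \<le> \<eta>" and "\<eta> < 1"
  shows "A \<noteq> {}"
    and "- (\<Sum>x\<in>\<Omega>. pmf p x * log 2 (pmf p x))
      \<le> 1 + log 2 (card A) + \<eta> * log 2 (card \<Omega>)"
proof -
  have [simp]: "finite A" using assms finite_subset by blast
  have total: "sum (pmf p) \<Omega> = 1" by (rule sum_pmf_eq_1[OF assms(1,2)])
  have rest: "sum (pmf p) (\<Omega> - A) \<le> \<eta>"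
    using unlikely assms(1) by (simp add: measure_measure_pmf_finite)
  show ne: "A \<noteq> {}" using rest total \<open>\<eta> < 1\<close> by auto
  then have A: "card A \<ge> 1" by (simp add: Suc_le_eq card_gt_0_iff)
  then have \<Omega>: "card \<Omega> \<ge> 1" using card_mono[OF assms(1,3)] by linarith
  define q where "q x = (if x \<in> A then 1 / (2 * real (card A)) else 1 / (2 * real (card \<Omega>)))" for x
  have split: "sum f \<Omega> = sum f A + sum f (\<Omega> - A)" for f :: "'a \<Rightarrow> real"
    using sum.subset_diff[OF assms(3,1), of f] by simp
  have "sum q (\<Omega> - A) = card (\<Omega> - A) / (2 * real (card \<Omega>))" by (simp add: q_def)
  also have "\<dots> \<le> card \<Omega> / (2 * real (card \<Omega>))"
    using assms(1) by (intro divide_right_mono) (simp_all add: card_mono)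
  also have "\<dots> = 1 / 2" using \<Omega> by simp
  finally have "sum q (\<Omega> - A) \<le> 1 / 2" .
  moreover have "sum q A = 1 / 2" using A ne by (simp add: q_def)
  ultimately have "sum q \<Omega> \<le> 1" by (simp add: split)
  then have "- (\<Sum>x\<in>\<Omega>. pmf p x * log 2 (pmf p x)) \<le> - (\<Sum>x\<in>\<Omega>. pmf p x * log 2 (q x))"
    using A \<Omega> by (intro entropy_le_cross_entropy assms) (simp_all add: q_def)
  also have "\<dots> = sum (pmf p) A * (1 + log 2 (card A)) + sum (pmf p) (\<Omega> - A) * (1 + log 2 (card \<Omega>))"
  proof -
    have "(\<Sum>x\<in>A. pmf p x * log 2 (q x)) = (\<Sum>x\<in>A. pmf p x * - (1 + log 2 (card A)))"
      using A ne by (intro sum.cong refl arg_cong2[where f = "(*)"]) (simp add: q_def log_divide log_mult)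
    moreover have "(\<Sum>x\<in>\<Omega> - A. pmf p x * log 2 (q x))
        = (\<Sum>x\<in>\<Omega> - A. pmf p x * - (1 + log 2 (card \<Omega>)))"
      using \<Omega> by (intro sum.cong refl arg_cong2[where f = "(*)"]) (simp add: q_def log_divide log_mult)
    ultimately show ?thesis unfolding split[of "\<lambda>x. pmf p x * log 2 (q x)"]
      by (simp only: sum_distrib_right[symmetric])
  qed
  also have "\<dots> = (sum (pmf p) A + sum (pmf p) (\<Omega> - A))
      + sum (pmf p) A * log 2 (card A) + sum (pmf p) (\<Omega> - A) * log 2 (card \<Omega>)"
    by (simp only: distrib_left mult_1_right ac_simps)
  also have "sum (pmf p) A + sum (pmf p) (\<Omega> - A) = 1"
    using total unfolding split .
  also have "1 + sum (pmf p) A * log 2 (card A) + sum (pmf p) (\<Omega> - A) * log 2 (card \<Omega>)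
      \<le> 1 + 1 * log 2 (card A) + \<eta> * log 2 (card \<Omega>)"
  proof -
    have "sum (pmf p) A \<le> 1"
      using total split[of "pmf p"] sum_nonneg[of "\<Omega> - A" "pmf p"] by simp
    then have "sum (pmf p) A * log 2 (card A) \<le> 1 * log 2 (card A)"
      using A by (intro mult_right_mono) simp_all
    moreover have "sum (pmf p) (\<Omega> - A) * log 2 (card \<Omega>) \<le> \<eta> * log 2 (card \<Omega>)"
      using rest \<Omega> by (intro mult_right_mono) simp_all
    ultimately show ?thesis by linarith
  qed
  finally show "- (\<Sum>x\<in>\<Omega>. pmf p x * log 2 (pmf p x))
      \<le> 1 + log 2 (card A) + \<eta> * log 2 (card \<Omega>)" by simp
qed

section \<open>Total variation distance\<close>

lemma bdd_above_tv: "bdd_above (range (\<lambda>W. \<bar>measure_pmf.prob \<mu> W - measure_pmf.prob \<nu> W\<bar>))"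
proof (rule bdd_aboveI2)
  fix W
  show "\<bar>measure_pmf.prob \<mu> W - measure_pmf.prob \<nu> W\<bar> \<le> 1"
    using measure_pmf.prob_le_1[of \<mu> W] measure_pmf.prob_le_1[of \<nu> W]
      measure_nonneg[of "measure_pmf \<mu>" W] measure_nonneg[of "measure_pmf \<nu>" W] by linarith
qed

lemma tv_distance_triangle: "tv_distance \<mu> \<nu> \<le> tv_distance \<mu> \<rho> + tv_distance \<rho> \<nu>"
  unfolding tv_distance_def[of \<mu> \<nu>]
proof (rule cSUP_least)
  fix W
  have "\<bar>measure_pmf.prob \<mu> W - measure_pmf.prob \<rho> W\<bar> \<le> tv_distance \<mu> \<rho>"
    unfolding tv_distance_def by (rule cSUP_upper[OF UNIV_I bdd_above_tv])
  moreover have "\<bar>measure_pmf.prob \<rho> W - measure_pmf.prob \<nu> W\<bar> \<le> tv_distance \<rho> \<nu>"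
    unfolding tv_distance_def by (rule cSUP_upper[OF UNIV_I bdd_above_tv])
  ultimately show "\<bar>measure_pmf.prob \<mu> W - measure_pmf.prob \<nu> W\<bar>
      \<le> tv_distance \<mu> \<rho> + tv_distance \<rho> \<nu>" by linarith
qed simp

lemma tv_distance_le_sum:
  assumes "finite \<Omega>" "set_pmf \<mu> \<subseteq> \<Omega>" "set_pmf \<nu> \<subseteq> \<Omega>"
  shows "tv_distance \<mu> \<nu> \<le> (\<Sum>x\<in>\<Omega>. \<bar>pmf \<mu> x - pmf \<nu> x\<bar>)"
  unfolding tv_distance_def
proof (rule cSUP_least)
  fix W
  have *: "measure_pmf.prob \<rho> W = sum (pmf \<rho>) (W \<inter> \<Omega>)" if "set_pmf \<rho> \<subseteq> \<Omega>" for \<rho>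
  proof -
    have "measure_pmf.prob \<rho> W = measure_pmf.prob \<rho> (W \<inter> \<Omega>)"
      using that measure_Int_set_pmf[of \<rho> W] measure_Int_set_pmf[of \<rho> "W \<inter> \<Omega>"]
      by (metis Int_assoc inf.absorb_iff2)
    then show ?thesis using assms(1) by (simp add: measure_measure_pmf_finite)
  qed
  have "\<bar>measure_pmf.prob \<mu> W - measure_pmf.prob \<nu> W\<bar> = \<bar>\<Sum>x\<in>W \<inter> \<Omega>. pmf \<mu> x - pmf \<nu> x\<bar>"
    using assms by (simp add: * sum_subtractf)
  also have "\<dots> \<le> (\<Sum>x\<in>W \<inter> \<Omega>. \<bar>pmf \<mu> x - pmf \<nu> x\<bar>)" by (rule sum_abs)
  also have "\<dots> \<le> (\<Sum>x\<in>\<Omega>. \<bar>pmf \<mu> x - pmf \<nu> x\<bar>)" using assms by (intro sum_mono2) auto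
  finally show "\<bar>measure_pmf.prob \<mu> W - measure_pmf.prob \<nu> W\<bar> \<le> (\<Sum>x\<in>\<Omega>. \<bar>pmf \<mu> x - pmf \<nu> x\<bar>)" .
qed simp

lemma neighbourhood_triangle:
  assumes "\<mu> \<in> neighbourhood \<delta> S \<Gamma>" "\<rho> \<in> prob_measures S" "tv_distance \<rho> \<mu> \<le> \<epsilon>"
  shows "\<rho> \<in> neighbourhood (\<epsilon> + \<delta>) S \<Gamma>"
proof -
  have "(INF \<nu>\<in>\<Gamma>. ereal (tv_distance \<rho> \<nu>)) \<le> ereal (\<epsilon> + \<delta>)"
  (* the infimum need not be attained, hence the slack e *)
  proof (rule ereal_le_epsilon2)
    fix e :: real assume "0 < e"
    have "(INF \<nu>\<in>\<Gamma>. ereal (tv_distance \<mu> \<nu>)) \<le> ereal \<delta>"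
      using assms(1) by (simp add: neighbourhood_def)
    then have "(INF \<nu>\<in>\<Gamma>. ereal (tv_distance \<mu> \<nu>)) < ereal (\<delta> + e)"
      by (rule order.strict_trans1) (use \<open>0 < e\<close> in simp)
    then obtain \<nu> where \<nu>: "\<nu> \<in> \<Gamma>" "tv_distance \<mu> \<nu> < \<delta> + e"
      unfolding INF_less_iff by auto
    then have "tv_distance \<rho> \<nu> \<le> \<epsilon> + \<delta> + e"
      using tv_distance_triangle[of \<rho> \<nu> \<mu>] assms(3) by linarith
    then show "(INF \<nu>\<in>\<Gamma>. ereal (tv_distance \<rho> \<nu>)) \<le> ereal (\<epsilon> + \<delta>) + ereal e"
      using INF_lower2[OF \<nu>(1), of "\<lambda>\<nu>. ereal (tv_distance \<rho> \<nu>)"] by simp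
  qed
  then show ?thesis using assms(2) unfolding neighbourhood_def by blast
qed

section \<open>Chebyshev's inequality for weakly dependent events\<close>

text \<open>
  Only dependent pairs contribute to the variance of the number of events that occur, each at most
  \<open>1\<close>, and there are at most \<open>K\<close> such pairs for each event.
\<close>

lemma weakly_dependent_Chebyshev:
  fixes M :: "'b pmf" and A :: "'v \<Rightarrow> 'b set"
  assumes "finite V" "0 < t"
    and few: "\<And>v. v \<in> V \<Longrightarrow> card {v'\<in>V. measure_pmf.prob M (A v \<inter> A v')
        \<noteq> measure_pmf.prob M (A v) * measure_pmf.prob M (A v')} \<le> K"
  shows "measure_pmf.prob M {x. t \<le> \<bar>real (card {v\<in>V. x \<in> A v}) - (\<Sum>v\<in>V. measure_pmf.prob M (A v))\<bar>}
    \<le> real (card V * K) / t\<^sup>2"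
proof -
  let ?P = "measure_pmf.prob M"
  define N where "N x = (\<Sum>v\<in>V. indicator (A v) x :: real)" for x
  have N_card: "N x = real (card {v\<in>V. x \<in> A v})" for x
    using assms(1) by (simp add: N_def indicator_def sum.If_cases Int_def)
  have N_sq: "(N x)\<^sup>2 = (\<Sum>v\<in>V. \<Sum>v'\<in>V. indicator (A v \<inter> A v') x)" for x
    by (simp add: N_def power2_eq_square sum_product indicator_inter_arith)
  have int_ind: "integrable M (indicator B :: 'b \<Rightarrow> real)" for B
    by (rule measure_pmf.integrable_const_bound[where B = 1]) (auto simp: indicator_def)
  have int_N: "integrable M N" unfolding N_def by (intro Bochner_Integration.integrable_sum int_ind)
  have int_N2: "integrable M (\<lambda>x. (N x)\<^sup>2)"
    unfolding N_sq by (intro Bochner_Integration.integrable_sum int_ind)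
  have exp_N: "measure_pmf.expectation M N = (\<Sum>v\<in>V. ?P (A v))"
    unfolding N_def by (simp add: Bochner_Integration.integral_sum int_ind)
  have "measure_pmf.variance M N
      = measure_pmf.expectation M (\<lambda>x. (N x)\<^sup>2) - (measure_pmf.expectation M N)\<^sup>2"
    by (rule measure_pmf.variance_eq[OF int_N int_N2])
  also have "\<dots> = (\<Sum>v\<in>V. \<Sum>v'\<in>V. ?P (A v \<inter> A v')) - (\<Sum>v\<in>V. ?P (A v))\<^sup>2"
    unfolding exp_N N_sq
    by (simp add: Bochner_Integration.integral_sum Bochner_Integration.integrable_sum int_ind)
  also have "\<dots> = (\<Sum>v\<in>V. \<Sum>v'\<in>V. ?P (A v \<inter> A v') - ?P (A v) * ?P (A v'))"
    by (simp add: power2_eq_square sum_product sum_subtractf)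
  also have "\<dots> \<le> (\<Sum>v\<in>V. real K)"
  proof (rule sum_mono)
    fix v assume v: "v \<in> V"
    let ?D = "{v'\<in>V. ?P (A v \<inter> A v') \<noteq> ?P (A v) * ?P (A v')}"
    have "(\<Sum>v'\<in>V. ?P (A v \<inter> A v') - ?P (A v) * ?P (A v'))
        = (\<Sum>v'\<in>?D. ?P (A v \<inter> A v') - ?P (A v) * ?P (A v'))"
      using assms(1) by (intro sum.mono_neutral_right) auto
    also have "\<dots> \<le> (\<Sum>v'\<in>?D. 1)"
    proof (rule sum_mono)
      fix v'
      have "0 \<le> ?P (A v) * ?P (A v')" by simp
      then show "?P (A v \<inter> A v') - ?P (A v) * ?P (A v') \<le> 1"
        using measure_pmf.prob_le_1[of M "A v \<inter> A v'"] by linarith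
    qed
    also have "\<dots> \<le> real K" using few[OF v] by simp
    finally show "(\<Sum>v'\<in>V. ?P (A v \<inter> A v') - ?P (A v) * ?P (A v')) \<le> real K" .
  qed
  finally have var: "measure_pmf.variance M N \<le> real (card V * K)" by simp
  have "?P {x. t \<le> \<bar>N x - (\<Sum>v\<in>V. ?P (A v))\<bar>} \<le> measure_pmf.variance M N / t\<^sup>2"
    using measure_pmf.Chebyshev_inequality[of N M t] int_N2 \<open>0 < t\<close> by (simp add: exp_N)
  also have "\<dots> \<le> real (card V * K) / t\<^sup>2" using var by (rule divide_right_mono) simp
  finally show ?thesis by (simp add: N_card)
qed

section \<open>Windows of a random block\<close>

lemma finite_configs: "finite S \<Longrightarrow> finite (configs S :: ('v \<Rightarrow> 'a::finite) set)"
  unfolding configs_def by (intro finite_PiE) simp_all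

lemma cube_nonempty: "0 < n \<Longrightarrow> cube n \<noteq> ({} :: (int ^ 'd) set)"
  using card_cube[of n, where 'd = 'd] by auto

lemma window_in_configs: "window S v x \<in> configs S"
  by (simp add: window_def configs_def)

lemma vmod_in_cube: "0 < n \<Longrightarrow> vmod v n \<in> cube n"
  by (simp add: vmod_def cube_def)

lemma vmod_add_eqD:
  assumes "vmod (v + s) n = vmod (v' + s') n" "v' \<in> cube n"
  shows "v' = vmod (v + s - s') n"
proof (rule vec_eq_iff[THEN iffD2], rule allI)
  fix i
  have "(v $ i + s $ i) mod int n = (v' $ i + s' $ i) mod int n"
    using assms(1) by (simp add: vmod_def vec_eq_iff)
  then have "(v $ i + s $ i - s' $ i) mod int n = (v' $ i + s' $ i - s' $ i) mod int n"
    by (rule mod_diff_cong) (rule refl)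
  also have "\<dots> = v' $ i" using assms(2) by (simp add: cube_def)
  finally show "v' $ i = vmod (v + s - s') n $ i" by (simp add: vmod_def)
qed

definition overlapping :: "nat \<Rightarrow> (int ^ 'd) set \<Rightarrow> int ^ 'd \<Rightarrow> int ^ 'd \<Rightarrow> bool" where
  "overlapping n S v v' \<longleftrightarrow> (\<exists>s\<in>S. \<exists>s'\<in>S. vmod (v + s) n = vmod (v' + s') n)"

text \<open>A common site determines \<open>v'\<close> from \<open>v\<close> and the two offsets of that site.\<close>

lemma card_overlapping_le:
  assumes "finite S"
  shows "card {v' \<in> cube n. overlapping n S v v'} \<le> (card S)\<^sup>2"
proof -
  have "{v' \<in> cube n. overlapping n S v v'} \<subseteq> (\<lambda>(s, s'). vmod (v + s - s') n) ` (S \<times> S)"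
    by (auto simp: overlapping_def dest: vmod_add_eqD)
  then have "card {v' \<in> cube n. overlapping n S v v'} \<le> card (S \<times> S)"
    using assms by (intro surj_card_le) simp_all
  then show ?thesis by (simp add: card_cartesian_product power2_eq_square)
qed

text \<open>
  The event that a given pattern is seen at \<open>v\<close> is a box: it constrains each site \<open>u\<close> of the cube
  separately. Where the windows do not overlap, at each site at most one of the two boxes constrains
  anything, so the probability of the intersection, a product over the sites, factorises.
\<close>

lemma prob_window_inter:
  fixes S :: "(int ^ 'd) set" and \<sigma> :: "int ^ 'd \<Rightarrow> 'a"
  assumes "0 < n" "\<sigma> \<in> configs S" "\<not> overlapping n S v v'"
  shows "measure_pmf.prob (Pi_pmf (cube n) undefined p)
      ({x. window S v (periodic_ext n x) = \<sigma>} \<inter> {x. window S v' (periodic_ext n x) = \<sigma>})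
    = measure_pmf.prob (Pi_pmf (cube n) undefined p) {x. window S v (periodic_ext n x) = \<sigma>}
      * measure_pmf.prob (Pi_pmf (cube n) undefined p) {x. window S v' (periodic_ext n x) = \<sigma>}"
proof -
  define B where "B w u = {a. \<forall>s\<in>S. vmod (w + s) n = u \<longrightarrow> a = \<sigma> s}" for w u
  have box: "{x. window S w (periodic_ext n x) = \<sigma>} = Pi (cube n) (B w)" for w
  proof (intro set_eqI iffI)
    fix x assume "x \<in> {x. window S w (periodic_ext n x) = \<sigma>}"
    then show "x \<in> Pi (cube n) (B w)" by (auto simp: B_def window_def periodic_ext_def)
  next
    fix x assume x: "x \<in> Pi (cube n) (B w)"
    have "x (vmod (w + s) n) = \<sigma> s" if "s \<in> S" for s
      using x vmod_in_cube[OF assms(1), of "w + s"] that by (auto simp: B_def Pi_def)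
    then show "x \<in> {x. window S w (periodic_ext n x) = \<sigma>}"
      using assms(2) by (auto simp: window_def periodic_ext_def configs_def PiE_def extensional_def)
  qed
  have "measure_pmf.prob (p u) (B v u \<inter> B v' u)
      = measure_pmf.prob (p u) (B v u) * measure_pmf.prob (p u) (B v' u)" for u
  proof -
    have "B v u = UNIV \<or> B v' u = UNIV"
      using assms(3) by (auto simp: B_def overlapping_def)
    then show ?thesis by (auto simp: measure_pmf.prob_space[simplified])
  qed
  then show ?thesis
    by (simp add: box Pi_Int measure_Pi_pmf_Pi finite_cube prod.distrib)
qed

lemma pmf_empirical:
  fixes S :: "(int ^ 'd) set"
  assumes "0 < n"
  shows "pmf (empirical n S x) \<sigma>
    = real (card {v \<in> cube n. window S v (periodic_ext n x) = \<sigma>}) / real n ^ CARD('d)"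
  unfolding empirical_def pmf_map
  by (subst measure_pmf_of_set)
    (use assms in \<open>simp_all add: cube_nonempty finite_cube card_cube vimage_def Int_def\<close>)

lemma empirical_in_prob_measures: "empirical n S x \<in> prob_measures S"
  by (auto simp: empirical_def prob_measures_def window_in_configs)

lemma averaged_marginal_in_prob_measures: "averaged_marginal n S \<mu> \<in> prob_measures S"
  by (auto simp: averaged_marginal_def marginal_def prob_measures_def window_in_configs)

text \<open>
  Chebyshev's inequality for the number of windows that show \<open>\<sigma>\<close>, with \<open>K = |S|\<^sup>2\<close> and threshold
  \<open>\<delta> n\<^sup>d\<close>: this number is \<open>n\<^sup>d\<close> times the empirical weight of \<open>\<sigma>\<close>, and its expectation is \<open>n\<^sup>d\<close> times
  the weight of \<open>\<sigma>\<close> under the averaged marginal.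
\<close>

lemma pattern_frequency_concentration:
  fixes S :: "(int ^ 'd) set" and \<sigma> :: "int ^ 'd \<Rightarrow> 'a"
  assumes "finite S" "0 < n" "0 < \<delta>" "\<sigma> \<in> configs S" and \<mu>: "\<mu> = Pi_pmf (cube n) undefined p"
  shows "measure_pmf.prob \<mu> {x. \<delta> \<le> \<bar>pmf (empirical n S x) \<sigma> - pmf (averaged_marginal n S \<mu>) \<sigma>\<bar>}
    \<le> (real (card S))\<^sup>2 / \<delta>\<^sup>2 / real n ^ CARD('d)"
proof -
  define m where "m = real n ^ CARD('d)"
  have m: "0 < m" using assms(2) by (simp add: m_def)
  define A where "A v = {x. window S v (periodic_ext n x) = \<sigma>}" for v
  let ?E = "\<Sum>v\<in>cube n. measure_pmf.prob \<mu> (A v)"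
  have "measure_pmf.prob \<mu> {x. \<delta> * m \<le> \<bar>real (card {v\<in>cube n. x \<in> A v}) - ?E\<bar>}
      \<le> real (card (cube n :: (int ^ 'd) set) * (card S)\<^sup>2) / (\<delta> * m)\<^sup>2"
  proof (rule weakly_dependent_Chebyshev)
    fix v :: "int ^ 'd"
    have "{v' \<in> cube n. measure_pmf.prob \<mu> (A v \<inter> A v')
          \<noteq> measure_pmf.prob \<mu> (A v) * measure_pmf.prob \<mu> (A v')}
        \<subseteq> {v' \<in> cube n. overlapping n S v v'}"
      using prob_window_inter[OF assms(2,4)] unfolding A_def \<mu> by blast
    then show "card {v' \<in> cube n. measure_pmf.prob \<mu> (A v \<inter> A v')
          \<noteq> measure_pmf.prob \<mu> (A v) * measure_pmf.prob \<mu> (A v')} \<le> (card S)\<^sup>2"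
      by (rule order_trans[OF card_mono card_overlapping_le[OF assms(1)], rotated])
        (simp add: finite_cube)
  qed (use m assms(3) in \<open>simp_all add: finite_cube\<close>)
  also have "\<dots> = (real (card S))\<^sup>2 / \<delta>\<^sup>2 / m"
    using m by (simp add: card_cube power_mult_distrib m_def[symmetric] power2_eq_square)
  also have "{x. \<delta> * m \<le> \<bar>real (card {v\<in>cube n. x \<in> A v}) - ?E\<bar>}
      = {x. \<delta> \<le> \<bar>pmf (empirical n S x) \<sigma> - pmf (averaged_marginal n S \<mu>) \<sigma>\<bar>}"
  proof -
    have "pmf (marginal n S v \<mu>) \<sigma> = measure_pmf.prob \<mu> (A v)" for v
      by (simp add: marginal_def pmf_map vimage_def A_def)
    then have avg: "pmf (averaged_marginal n S \<mu>) \<sigma> = ?E / m"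
      using assms(2) by (simp add: pmf_averaged_marginal m_def)
    have "\<bar>pmf (empirical n S x) \<sigma> - pmf (averaged_marginal n S \<mu>) \<sigma>\<bar>
        = \<bar>real (card {v\<in>cube n. x \<in> A v}) - ?E\<bar> / m" for x
      using m by (simp add: avg pmf_empirical[OF assms(2)] A_def flip: m_def diff_divide_distrib)
    then show ?thesis using m by (simp add: pos_le_divide_eq)
  qed
  finally show ?thesis by (simp add: m_def)
qed

section \<open>Comparing entropy and number of admissible blocks\<close>

text \<open>
  The number of patterns, hence the constant, depends on the alphabet through its type only, so the
  type is passed as an argument.
\<close>

definition failure_constant :: "(int ^ 'd) set \<Rightarrow> real \<Rightarrow> 'a::finite itself \<Rightarrow> real" where
  "failure_constant S \<epsilon> _ =
     (let C = real (card (configs S :: (int ^ 'd \<Rightarrow> 'a) set)) in C * ((real (card S))\<^sup>2 / (\<epsilon> / C)\<^sup>2))"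

text \<open>
  If each of the \<open>C = |\<Sigma>\<^sup>S|\<close> pattern frequencies is within \<open>\<epsilon> / C\<close> of its expectation, then the
  total variation distance is at most \<open>\<epsilon>\<close>; the constant comes from the union bound over the patterns.
\<close>

lemma prob_not_admissible_le:
  fixes S :: "(int ^ 'd) set" and \<Gamma> :: "(int ^ 'd \<Rightarrow> 'a::finite) pmf set"
  assumes "finite S" "0 < n" "0 < \<epsilon>" "\<mu> \<in> admissible_products n S (neighbourhood \<delta> S \<Gamma>)"
  shows "measure_pmf.prob \<mu> (configs (cube n) - admissible_blocks n S (neighbourhood (\<epsilon> + \<delta>) S \<Gamma>))
    \<le> failure_constant S \<epsilon> TYPE('a) / real n ^ CARD('d)"
proof -
  obtain p where p: "\<mu> = Pi_pmf (cube n) undefined p"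
    and near: "averaged_marginal n S \<mu> \<in> neighbourhood \<delta> S \<Gamma>"
    using assms(4) by (auto simp: admissible_products_def)
  define P where "P = (configs S :: (int ^ 'd \<Rightarrow> 'a) set)"
  have fin: "finite P" using assms(1) by (simp add: P_def finite_configs)
  have "P \<noteq> {}" using window_in_configs unfolding P_def by blast
  then have C: "0 < real (card P)" using fin by (simp add: card_gt_0_iff)
  define \<gamma> where "\<gamma> = \<epsilon> / real (card P)"
  have \<gamma>: "0 < \<gamma>" using C assms(3) by (simp add: \<gamma>_def)
  define bad where
    "bad \<sigma> = {x. \<gamma> \<le> \<bar>pmf (empirical n S x) \<sigma> - pmf (averaged_marginal n S \<mu>) \<sigma>\<bar>}" for \<sigma>
  have "x \<in> (\<Union>\<sigma>\<in>P. bad \<sigma>)"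
    if x: "x \<in> configs (cube n) - admissible_blocks n S (neighbourhood (\<epsilon> + \<delta>) S \<Gamma>)" for x
  proof (rule ccontr)
    assume good: "x \<notin> (\<Union>\<sigma>\<in>P. bad \<sigma>)"
    have "tv_distance (empirical n S x) (averaged_marginal n S \<mu>)
        \<le> (\<Sum>\<sigma>\<in>P. \<bar>pmf (empirical n S x) \<sigma> - pmf (averaged_marginal n S \<mu>) \<sigma>\<bar>)"
      using empirical_in_prob_measures[of n S x] averaged_marginal_in_prob_measures[of n S \<mu>] fin
      by (intro tv_distance_le_sum) (simp_all add: prob_measures_def P_def)
    also have "\<dots> \<le> (\<Sum>\<sigma>\<in>P. \<gamma>)" using good by (intro sum_mono) (auto simp: bad_def)
    also have "\<dots> = \<epsilon>" using C by (simp add: \<gamma>_def)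
    finally have "empirical n S x \<in> neighbourhood (\<epsilon> + \<delta>) S \<Gamma>"
      by (rule neighbourhood_triangle[OF near empirical_in_prob_measures])
    then show False using x by (simp add: admissible_blocks_def)
  qed
  then have "measure_pmf.prob \<mu> (configs (cube n) - admissible_blocks n S (neighbourhood (\<epsilon> + \<delta>) S \<Gamma>))
      \<le> measure_pmf.prob \<mu> (\<Union>\<sigma>\<in>P. bad \<sigma>)"
    by (intro measure_pmf.finite_measure_mono) auto
  also have "\<dots> \<le> (\<Sum>\<sigma>\<in>P. measure_pmf.prob \<mu> (bad \<sigma>))"
    using fin by (intro measure_UNION_le) simp_all
  also have "\<dots> \<le> (\<Sum>\<sigma>\<in>P. (real (card S))\<^sup>2 / \<gamma>\<^sup>2 / real n ^ CARD('d))"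
    unfolding bad_def P_def
    by (intro sum_mono pattern_frequency_concentration[OF assms(1,2) \<gamma> _ p])
  also have "\<dots> = failure_constant S \<epsilon> TYPE('a) / real n ^ CARD('d)"
    by (simp add: failure_constant_def Let_def P_def \<gamma>_def)
  finally show ?thesis .
qed

text \<open>
  If some admissible product measure exists and \<open>\<eta> < 1\<close>, then the set of blocks has positive measure
  and is not empty. So the count on the right is \<open>-\<infinity>\<close> only where there is no \<open>\<mu>\<close> to bound, which
  keeps the two conventions for \<open>-\<infinity>\<close> consistent.
\<close>

lemma admissible_product_entropy_le:
  fixes S :: "(int ^ 'd) set" and \<Gamma> :: "(int ^ 'd \<Rightarrow> 'a::finite) pmf set"
  assumes "finite S" "0 < n" "0 < \<epsilon>" "\<mu> \<in> admissible_products n S (neighbourhood \<delta> S \<Gamma>)"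
    and \<eta>: "\<eta> = failure_constant S \<epsilon> TYPE('a) / real n ^ CARD('d)" "\<eta> < 1"
  shows "ereal (1 / real n ^ CARD('d) * entropy2 (cube n) \<mu>)
    \<le> ereal (1 / real n ^ CARD('d) + \<eta> * log 2 CARD('a))
      + ereal (1 / real n ^ CARD('d))
        * elog2 (card (admissible_blocks n S (neighbourhood (\<epsilon> + \<delta>) S \<Gamma>)))"
proof -
  define m where "m = real n ^ CARD('d)"
  have m: "0 < m" using assms(2) by (simp add: m_def)
  define \<Omega> where "\<Omega> = (configs (cube n) :: (int ^ 'd \<Rightarrow> 'a) set)"
  let ?A = "admissible_blocks n S (neighbourhood (\<epsilon> + \<delta>) S \<Gamma>)"
  obtain p where p: "\<mu> = Pi_pmf (cube n) undefined p"
    using assms(4) by (auto simp: admissible_products_def)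
  have fin: "finite \<Omega>" by (simp add: \<Omega>_def finite_configs finite_cube)
  have supp: "set_pmf \<mu> \<subseteq> \<Omega>"
    using set_Pi_pmf_subset[OF finite_cube, of n undefined p]
    by (auto simp: p \<Omega>_def configs_def PiE_def extensional_def)
  have sub: "?A \<subseteq> \<Omega>" by (auto simp: admissible_blocks_def \<Omega>_def)
  have unlikely: "measure_pmf.prob \<mu> (\<Omega> - ?A) \<le> \<eta>"
    unfolding \<Omega>_def \<eta> by (rule prob_not_admissible_le[OF assms(1-4)])
  note likely = entropy_le_log_card_of_likely_set[OF fin supp sub unlikely \<eta>(2)]
  have "card \<Omega> = CARD('a) ^ (n ^ CARD('d))"
    by (simp add: \<Omega>_def configs_def card_PiE finite_cube card_cube)
  then have "log 2 (card \<Omega>) = m * log 2 CARD('a)"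
    by (simp add: m_def log_nat_power)
  with likely(2) have "entropy2 (cube n) \<mu> \<le> 1 + log 2 (card ?A) + \<eta> * (m * log 2 CARD('a))"
    by (simp add: entropy2_def \<Omega>_def)
  then have "1 / m * entropy2 (cube n) \<mu>
      \<le> 1 / m * (1 + log 2 (card ?A) + \<eta> * (m * log 2 CARD('a)))"
    using m by (intro mult_left_mono) simp_all
  also have "\<dots> = (1 / m + \<eta> * log 2 CARD('a)) + 1 / m * log 2 (card ?A)"
    using m by (simp add: field_simps)
  finally have "1 / m * entropy2 (cube n) \<mu>
      \<le> (1 / m + \<eta> * log 2 CARD('a)) + 1 / m * log 2 (card ?A)" .
  moreover have "card ?A \<noteq> 0" using likely(1) by (simp add: finite_admissible_blocks)
  ultimately show ?thesis by (simp add: elog2_def m_def)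
qed

lemma h_ind_hat_le_block_growth_rate:
  fixes S :: "(int ^ 'd) set" and \<Gamma> :: "(int ^ 'd \<Rightarrow> 'a::finite) pmf set"
  assumes "finite S" "0 < \<epsilon>"
  shows "h_ind_hat S (neighbourhood \<delta> S \<Gamma>) \<le> block_growth_rate S (neighbourhood (\<epsilon> + \<delta>) S \<Gamma>)"
proof -
  define \<eta> where "\<eta> n = failure_constant S \<epsilon> TYPE('a) / real n ^ CARD('d)" for n
  define r where "r n = 1 / real n ^ CARD('d) + \<eta> n * log 2 CARD('a)" for n
  define g where "g = (\<lambda>n. ereal (1 / real n ^ CARD('d))
      * elog2 (card (admissible_blocks n S (neighbourhood (\<epsilon> + \<delta>) S \<Gamma>))))"
  have lim: "(\<lambda>n. c / real n ^ CARD('d)) \<longlonglongrightarrow> 0" for c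
    by (intro tendsto_divide_0[OF tendsto_const] filterlim_at_top_imp_at_infinity
        filterlim_pow_at_top filterlim_real_sequentially) simp
  have \<eta>: "\<eta> \<longlonglongrightarrow> 0" unfolding \<eta>_def by (rule lim)
  have "r \<longlonglongrightarrow> 0 + 0 * log 2 CARD('a)"
    unfolding r_def by (intro tendsto_add tendsto_mult lim \<eta> tendsto_const)
  then have r: "(\<lambda>n. ereal (r n)) \<longlonglongrightarrow> 0" by (simp add: zero_ereal_def)
  have "\<forall>\<^sub>F n in sequentially. \<eta> n < 1 \<and> 0 < n"
    using order_tendstoD(2)[OF \<eta>, of 1] eventually_gt_at_top[of 0] by (auto elim: eventually_conj)
  then have "\<forall>\<^sub>F n in sequentially. (SUP \<mu>\<in>admissible_products n S (neighbourhood \<delta> S \<Gamma>).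
      ereal (1 / real n ^ CARD('d) * entropy2 (cube n) \<mu>)) \<le> ereal (r n) + g n"
  proof eventually_elim
    case (elim n)
    then show ?case
      unfolding r_def g_def
      by (intro SUP_least admissible_product_entropy_le[OF assms(1) _ assms(2)])
        (simp_all add: \<eta>_def)
  qed
  then have "h_ind_hat S (neighbourhood \<delta> S \<Gamma>) \<le> limsup (\<lambda>n. ereal (r n) + g n)"
    unfolding h_ind_hat_def by (rule Limsup_mono)
  also have "\<dots> = limsup g" using ereal_limsup_lim_add[OF r, of g] by simp
  finally show ?thesis unfolding block_growth_rate_def g_def .
qed

theorem theorem26:
  fixes S :: "(int ^ 'd) set"
    and \<Gamma> :: "(int ^ 'd \<Rightarrow> 'a::finite) pmf set"
  assumes "finite S"
    and "semiconstrained_system S \<Gamma>"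
  shows "h_ind S \<Gamma> \<le> capacity S \<Gamma>"
proof (rule tendsto_le)
  have "filterlim (\<lambda>\<epsilon>. \<epsilon> + \<epsilon>) (at_right 0) (at_right (0::real))"
    unfolding filterlim_at
  proof
    show "((\<lambda>\<epsilon>. \<epsilon> + \<epsilon>) \<longlongrightarrow> 0) (at_right (0::real))"
      using tendsto_add[OF tendsto_ident_at[of 0 "{0<..}"] tendsto_ident_at] unfolding add_0_left .
  qed (simp add: eventually_at_filter)
  then show "((\<lambda>\<epsilon>. block_growth_rate S (neighbourhood (\<epsilon> + \<epsilon>) S \<Gamma>)) \<longlongrightarrow> capacity S \<Gamma>) (at_right 0)"
    by (rule filterlim_compose[OF capacity_tendsto])
  show "((\<lambda>\<epsilon>. h_ind_hat S (neighbourhood \<epsilon> S \<Gamma>)) \<longlongrightarrow> h_ind S \<Gamma>) (at_right 0)"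
    by (rule h_ind_tendsto)
  show "\<forall>\<^sub>F \<epsilon> in at_right 0. h_ind_hat S (neighbourhood \<epsilon> S \<Gamma>)
      \<le> block_growth_rate S (neighbourhood (\<epsilon> + \<epsilon>) S \<Gamma>)"
    using eventually_at_right_less
    by eventually_elim (rule h_ind_hat_le_block_growth_rate[OF assms(1)])
qed simp

end
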